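(* The Finsler band model $(\mathbb{B},F_B)$ is isometric to the Finsler-Poincaré upper half plane $(\mathbb{U},F_U)$; that is, there is a diffeomorphism $\varphi:\mathbb{B}\to\mathbb{U}$ such that $F_U(\varphi(x),D\varphi_x(v))=F_B(x,v)$ for all $(x,v)\in T\mathbb{B}$.
   Context: Coordinates are written with subscripts, $x=(x_1,x_2)$, $v=(v_1,v_2)$; $|\cdot|$ and $\langle\cdot,\cdot\rangle$ are the Euclidean norm and inner product. $\mathbb{B}=\{(x_1,x_2)\in\mathbb{R}^2:-\frac{\pi}{2}<x_2<\frac{\pi}{2}\}$ with $F_B(x,v)=\dfrac{|v|}{\cos x_2}+\dfrac{(e^{2x_1}-4)v_1\cos x_2+(e^{2x_1}+4)v_2\sin x_2}{(e^{2x_1}+4)\cos x_2}$. $\mathbb{U}=\{(x_1,x_2)\in\mathbb{R}^2:x_2>0\}$ with $F_U(x,v)=\dfrac{|v|}{x_2}+\dfrac{\langle w(x),v\rangle}{x_2(4+|x|^2)}$, where $w(x)=(2x_1x_2,\;x_2^2-x_1^2-4)$. *)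

theory Defs
  imports "HOL-Analysis.Analysis"
begin

text \<open>Differentiability is taken at the points of \<open>S\<close> with respect to the whole space, so these
  notions are meant for open \<open>S\<close>. For finite-dimensional domains, continuity of all iterated
  directional derivatives is the usual \<open>C\<^sup>k\<close> condition.\<close>

primrec Ck_on :: "nat \<Rightarrow> 'a::real_normed_vector set \<Rightarrow> ('a \<Rightarrow> 'b::real_normed_vector) \<Rightarrow> bool" where
  "Ck_on 0 S f \<longleftrightarrow> continuous_on S f"
| "Ck_on (Suc k) S f \<longleftrightarrow> (\<forall>x\<in>S. f differentiable (at x)) \<and>
     (\<forall>v. Ck_on k S (\<lambda>x. frechet_derivative f (at x) v))"

definition smooth_on :: "'a::real_normed_vector set \<Rightarrow> ('a \<Rightarrow> 'b::real_normed_vector) \<Rightarrow> bool" where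
  "smooth_on S f \<longleftrightarrow> (\<forall>k. Ck_on k S f)"

definition diffeomorphism_on ::
    "'a::real_normed_vector set \<Rightarrow> 'b::real_normed_vector set \<Rightarrow> ('a \<Rightarrow> 'b) \<Rightarrow> bool" where
  "diffeomorphism_on S T f \<longleftrightarrow>
     bij_betw f S T \<and> smooth_on S f \<and> smooth_on T (inv_into S f)"

definition band :: "(real^2) set" where
  "band = {x. - (pi / 2) < x $ 2 \<and> x $ 2 < pi / 2}"

definition F_band :: "real^2 \<Rightarrow> real^2 \<Rightarrow> real" where
  "F_band x v = norm v / cos (x $ 2) +
     ((exp (2 * x $ 1) - 4) * v $ 1 * cos (x $ 2) + (exp (2 * x $ 1) + 4) * v $ 2 * sin (x $ 2)) /
     ((exp (2 * x $ 1) + 4) * cos (x $ 2))"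

definition upper_half_plane :: "(real^2) set" where
  "upper_half_plane = {x. x $ 2 > 0}"

definition w_upper :: "real^2 \<Rightarrow> real^2" where
  "w_upper x = vector [2 * x $ 1 * x $ 2, (x $ 2)\<^sup>2 - (x $ 1)\<^sup>2 - 4]"

definition F_upper :: "real^2 \<Rightarrow> real^2 \<Rightarrow> real" where
  "F_upper x v = norm v / x $ 2 + (w_upper x \<bullet> v) / (x $ 2 * (4 + (norm x)\<^sup>2))"

end

theory Submission
  imports Defs
begin

text \<open>Identifying \<open>x\<close> in the band with \<open>x\<^sub>1 + i x\<^sub>2\<close> and \<open>y\<close> in the half plane with
  \<open>y\<^sub>2 + i y\<^sub>1\<close>, the isometry is the complex exponential, with the principal branch of the
  logarithm as its inverse. It is conformal with factor \<open>exp x\<^sub>1\<close>, which takes care of the Riemannian part of the metric; the one-form is a direct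
  computation. The inverse is smooth because the components \<open>p\<close>, \<open>q\<close> of \<open>y / |y|\<^sup>2\<close>, which make up
  its first derivatives, have partial derivatives that are polynomials in \<open>p\<close> and \<open>q\<close>.\<close>

section \<open>Calculus of \<open>Ck_on\<close> on open sets\<close>

text \<open>Near a point of an open set, values outside the set do not matter, so derivatives agree
  as well. This allows functions specified only on \<open>S\<close>, such as
  \<open>inv_into\<close>, to be replaced by explicit formulas.\<close>

lemma Ck_on_cong:
  assumes "open S" "\<And>x. x \<in> S \<Longrightarrow> f x = g x" "Ck_on k S f"
  shows "Ck_on k S g"
  using assms(2,3)
proof (induction k arbitrary: f g)
  case 0
  then show ?case using continuous_on_cong[of S S f g] by simp
next
  case (Suc k)
  have D: "(g has_derivative frechet_derivative f (at x)) (at x)" if "x \<in> S" for x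
  proof -
    have "(f has_derivative frechet_derivative f (at x)) (at x)"
      using Suc.prems(2) that frechet_derivative_works by auto
    then show ?thesis
      using has_derivative_transform_within_open[OF _ assms(1) that] Suc.prems(1) by blast
  qed
  have "Ck_on k S (\<lambda>x. frechet_derivative g (at x) v)" for v
  proof (rule Suc.IH)
    show "Ck_on k S (\<lambda>x. frechet_derivative f (at x) v)"
      using Suc.prems(2) by simp
    show "frechet_derivative f (at x) v = frechet_derivative g (at x) v" if "x \<in> S" for x
      using frechet_derivative_at[OF D[OF that]] by simp
  qed
  then show ?case
    using D unfolding Ck_on.simps differentiable_def by blast
qed

text \<open>Trades \<open>frechet_derivative\<close> for an explicit formula: by uniqueness of
  derivatives the two agree on \<open>S\<close>, and \<open>Ck_on_cong\<close> does the
  rest.\<close>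

lemma Ck_on_SucI:
  assumes "open S" "\<And>x. x \<in> S \<Longrightarrow> (f has_derivative f' x) (at x)"
    and "\<And>v. Ck_on k S (\<lambda>x. f' x v)"
  shows "Ck_on (Suc k) S f"
proof -
  have "Ck_on k S (\<lambda>x. frechet_derivative f (at x) v)" for v
    by (rule Ck_on_cong[OF assms(1) _ assms(3)[of v]])
      (simp add: frechet_derivative_at[OF assms(2), symmetric])
  then show ?thesis
    using assms(2) unfolding Ck_on.simps differentiable_def by blast
qed

text \<open>The recursion reaches continuity only at order 0, where differentiability supplies it;
  higher orders pass to the derivatives.\<close>

lemma Ck_on_SucD:
  assumes "Ck_on (Suc k) S f"
  shows "Ck_on k S f"
  using assms
proof (induction k arbitrary: f)
  case 0
  then show ?case
    by (auto intro!: continuous_at_imp_continuous_on differentiable_imp_continuous_within)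
next
  case (Suc k)
  then show ?case by (metis Ck_on.simps(2))
qed

lemma Ck_on_subset: "Ck_on k S f \<Longrightarrow> T \<subseteq> S \<Longrightarrow> Ck_on k T f"
  by (induction k arbitrary: f) (auto intro: continuous_on_subset)

lemma Ck_on_const:
  assumes "open S"
  shows "Ck_on k S (\<lambda>_. c)"
proof (induction k arbitrary: c)
  case (Suc k)
  show ?case
    by (rule Ck_on_SucI[OF assms has_derivative_const Suc])
qed simp

lemma Ck_on_add:
  assumes "open S" "Ck_on k S f" "Ck_on k S g"
  shows "Ck_on k S (\<lambda>x. f x + g x)"
  using assms(2,3)
proof (induction k arbitrary: f g)
  case 0
  then show ?case by (simp add: continuous_on_add)
next
  case (Suc k)
  show ?case
  proof (rule Ck_on_SucI[OF assms(1)])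
    show "((\<lambda>x. f x + g x) has_derivative
        (\<lambda>v. frechet_derivative f (at x) v + frechet_derivative g (at x) v)) (at x)"
      if "x \<in> S" for x
      using Suc.prems that by (intro has_derivative_add) (auto simp: frechet_derivative_works)
    show "Ck_on k S (\<lambda>x. frechet_derivative f (at x) v + frechet_derivative g (at x) v)" for v
      using Suc.prems by (intro Suc.IH) auto
  qed
qed

lemma Ck_on_scaleR:
  fixes f :: "'a::real_normed_vector \<Rightarrow> real"
  assumes "open S" "Ck_on k S f" "Ck_on k S g"
  shows "Ck_on k S (\<lambda>x. f x *\<^sub>R g x)"
  using assms(2,3)
proof (induction k arbitrary: f g)
  case 0
  then show ?case by (simp add: continuous_on_scaleR)
next
  case (Suc k)
  show ?case
  proof (rule Ck_on_SucI[OF assms(1)])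
    show "((\<lambda>x. f x *\<^sub>R g x) has_derivative
        (\<lambda>v. f x *\<^sub>R frechet_derivative g (at x) v + frechet_derivative f (at x) v *\<^sub>R g x)) (at x)"
      if "x \<in> S" for x
      using Suc.prems that by (intro has_derivative_scaleR) (auto simp: frechet_derivative_works)
    \<comment> \<open>Each term of the product rule keeps one undifferentiated factor, whose order
      \<open>Ck_on_SucD\<close> lowers to \<open>k\<close>.\<close>
    show "Ck_on k S (\<lambda>x. f x *\<^sub>R frechet_derivative g (at x) v + frechet_derivative f (at x) v *\<^sub>R g x)"
      for v
      using Suc.prems by (auto intro!: Ck_on_add[OF assms(1)] Suc.IH intro: Ck_on_SucD)
  qed
qed

lemma Ck_on_mult:
  fixes f g :: "'a::real_normed_vector \<Rightarrow> real"
  assumes "open S" "Ck_on k S f" "Ck_on k S g"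
  shows "Ck_on k S (\<lambda>x. f x * g x)"
  using Ck_on_scaleR[OF assms] by simp

section \<open>The exponential and logarithm as inverse bijections\<close>

lemma open_band: "open band"
proof -
  have "band = {x. - (pi / 2) < x $ 2} \<inter> {x. x $ 2 < pi / 2}"
    by (auto simp: band_def)
  moreover have "open \<dots>"
    by (intro open_Int open_Collect_less continuous_intros)
  ultimately show ?thesis by simp
qed

lemma open_upper_half_plane: "open upper_half_plane"
  unfolding upper_half_plane_def by (auto intro!: open_Collect_less continuous_intros)

lemma vec_eq_2_iff: "x = y \<longleftrightarrow> x $ 1 = y $ 1 \<and> x $ 2 = y $ 2" for x y :: "'a ^ 2"
  by (simp add: vec_eq_iff forall_2)

text \<open>Real coefficients times constant axis vectors, a form to which \<open>Ck_on_add\<close>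
  and \<open>Ck_on_scaleR\<close> apply directly.\<close>

definition band_exp :: "real^2 \<Rightarrow> real^2" where
  "band_exp x = (exp (x $ 1) * sin (x $ 2)) *\<^sub>R axis 1 1 + (exp (x $ 1) * cos (x $ 2)) *\<^sub>R axis 2 1"

text \<open>For \<open>y $ 2 > 0\<close> the arctangent is the principal argument of
  \<open>y $ 2 + i * y $ 1\<close>, and half the logarithm of the squared modulus is the real
  part.\<close>

definition band_log :: "real^2 \<Rightarrow> real^2" where
  "band_log y = (ln ((y $ 1)\<^sup>2 + (y $ 2)\<^sup>2) / 2) *\<^sub>R axis 1 1 + arctan (y $ 1 / y $ 2) *\<^sub>R axis 2 1"

lemma band_exp_nth [simp]:
  "band_exp x $ 1 = exp (x $ 1) * sin (x $ 2)" "band_exp x $ 2 = exp (x $ 1) * cos (x $ 2)"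
  by (simp_all add: band_exp_def axis_def)

lemma band_log_nth [simp]:
  "band_log y $ 1 = ln ((y $ 1)\<^sup>2 + (y $ 2)\<^sup>2) / 2" "band_log y $ 2 = arctan (y $ 1 / y $ 2)"
  by (simp_all add: band_log_def axis_def)

lemma cos_pos_band: "x \<in> band \<Longrightarrow> cos (x $ 2) > 0"
  by (simp add: band_def cos_gt_zero_pi)

lemma band_log_in_band: "band_log y \<in> band"
  using arctan[of "y $ 1 / y $ 2"] by (simp add: band_def)

lemma band_exp_in_upper_half_plane: "x \<in> band \<Longrightarrow> band_exp x \<in> upper_half_plane"
  by (simp add: upper_half_plane_def cos_pos_band)

lemma sum_squares_band_exp: "(band_exp x $ 1)\<^sup>2 + (band_exp x $ 2)\<^sup>2 = exp (2 * x $ 1)"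
  by (simp add: power_mult_distrib exp_double flip: distrib_left)

lemma band_log_exp:
  assumes "x \<in> band"
  shows "band_log (band_exp x) = x"
proof -
  have "band_log (band_exp x) $ 1 = x $ 1"
    unfolding band_log_nth sum_squares_band_exp by simp
  moreover have "band_log (band_exp x) $ 2 = arctan (tan (x $ 2))"
    by (simp add: tan_def)
  moreover have "arctan (tan (x $ 2)) = x $ 2"
    using assms by (auto simp: band_def intro!: arctan_tan)
  ultimately show ?thesis by (simp add: vec_eq_2_iff)
qed

lemma band_exp_log:
  assumes "y \<in> upper_half_plane"
  shows "band_exp (band_log y) = y"
proof -
  let ?r = "sqrt ((y $ 1)\<^sup>2 + (y $ 2)\<^sup>2)"
  have y2: "y $ 2 > 0" using assms by (simp add: upper_half_plane_def)
  then have pos: "(y $ 1)\<^sup>2 + (y $ 2)\<^sup>2 > 0" by (simp add: add_nonneg_pos)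
  have "ln ((y $ 1)\<^sup>2 + (y $ 2)\<^sup>2) / 2 = ln ?r"
    using pos by (simp add: ln_sqrt)
  then have 1: "exp (ln ((y $ 1)\<^sup>2 + (y $ 2)\<^sup>2) / 2) = ?r"
    using pos by simp
  \<comment> \<open>This turns the root in \<open>sin_arctan\<close> and \<open>cos_arctan\<close>
    into \<open>?r / y $ 2\<close>, so that sine and cosine of the angle become
    \<open>y $ 1 / ?r\<close> and \<open>y $ 2 / ?r\<close>.\<close>
  have "1 + (y $ 1 / y $ 2)\<^sup>2 = ((y $ 1)\<^sup>2 + (y $ 2)\<^sup>2) / (y $ 2)\<^sup>2"
    using y2 by (simp add: power_divide field_simps)
  then have 2: "sqrt (1 + (y $ 1 / y $ 2)\<^sup>2) = ?r / y $ 2"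
    using y2 by (simp add: real_sqrt_divide)
  have r0: "?r > 0" using pos by simp
  show ?thesis
    unfolding vec_eq_2_iff band_exp_nth band_log_nth 1 sin_arctan cos_arctan 2
    using y2 r0 by (simp add: field_simps)
qed

lemma bij_betw_band_exp: "bij_betw band_exp band upper_half_plane"
  by (rule bij_betw_byWitness[where f' = band_log])
    (auto simp: band_log_exp band_exp_log band_log_in_band band_exp_in_upper_half_plane)

section \<open>Smoothness of the exponential and of its inverse\<close>

lemma has_derivative_nth [derivative_intros]:
  fixes f :: "'a::real_normed_vector \<Rightarrow> 'b::real_normed_vector ^ 'n"
  assumes "(f has_derivative f') F"
  shows "((\<lambda>x. f x $ i) has_derivative (\<lambda>v. f' v $ i)) F"
  using assms by (rule bounded_linear.has_derivative[OF bounded_linear_vec_nth])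

text \<open>One joint induction, since the linear span of the two functions is closed under partial
  derivatives.\<close>

lemma Ck_on_exp_sin_cos:
  "Ck_on k UNIV (\<lambda>x::real^2. exp (x $ 1) * sin (x $ 2)) \<and>
   Ck_on k UNIV (\<lambda>x::real^2. exp (x $ 1) * cos (x $ 2))"
proof (induction k)
  case 0
  show ?case by (auto intro!: continuous_intros)
next
  case (Suc k)
  let ?s = "\<lambda>x::real^2. exp (x $ 1) * sin (x $ 2)" and ?c = "\<lambda>x::real^2. exp (x $ 1) * cos (x $ 2)"
  have ds: "(?s has_derivative (\<lambda>v. ?s x * v $ 1 + ?c x * v $ 2)) (at x)" for x
    by (auto intro!: derivative_eq_intros simp: fun_eq_iff algebra_simps)
  have dc: "(?c has_derivative (\<lambda>v. ?c x * v $ 1 + ?s x * (- v $ 2))) (at x)" for x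
    by (auto intro!: derivative_eq_intros simp: fun_eq_iff algebra_simps)
  note intros = Ck_on_add Ck_on_mult Ck_on_const open_UNIV Suc[THEN conjunct1] Suc[THEN conjunct2]
  have "Ck_on (Suc k) UNIV ?s"
    by (rule Ck_on_SucI[OF open_UNIV ds]) (intro intros)
  moreover have "Ck_on (Suc k) UNIV ?c"
    by (rule Ck_on_SucI[OF open_UNIV dc]) (intro intros)
  ultimately show ?case ..
qed

lemma smooth_on_band_exp: "smooth_on band band_exp"
proof -
  have "Ck_on k UNIV band_exp" for k
    unfolding band_exp_def[abs_def]
    using Ck_on_exp_sin_cos by (intro Ck_on_add Ck_on_scaleR Ck_on_const open_UNIV) auto
  then show ?thesis
    unfolding smooth_on_def using Ck_on_subset by blast
qed

text \<open>Joint induction again: the derivatives of each function involve both, and only through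
  products that the induction hypothesis covers.\<close>

lemma Ck_on_inversion:
  "Ck_on k upper_half_plane (\<lambda>y. y $ 1 / ((y $ 1)\<^sup>2 + (y $ 2)\<^sup>2)) \<and>
   Ck_on k upper_half_plane (\<lambda>y. y $ 2 / ((y $ 1)\<^sup>2 + (y $ 2)\<^sup>2))"
proof (induction k)
  case 0
  show ?case
    by (auto intro!: continuous_intros simp: upper_half_plane_def sum_power2_eq_zero_iff)
next
  case (Suc k)
  let ?n = "\<lambda>y::real^2. (y $ 1)\<^sup>2 + (y $ 2)\<^sup>2"
  let ?p = "\<lambda>y::real^2. y $ 1 / ?n y" and ?q = "\<lambda>y::real^2. y $ 2 / ?n y"
  have n0: "?n y \<noteq> 0" if "y \<in> upper_half_plane" for y
    using that by (simp add: upper_half_plane_def sum_power2_eq_zero_iff)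
  have quot: "((\<lambda>y::real^2. y $ i / ?n y) has_derivative
      (\<lambda>v. (v $ i * ?n y - y $ i * (2 * (y $ 1 * v $ 1 + y $ 2 * v $ 2))) / (?n y * ?n y))) (at y)"
    if "y \<in> upper_half_plane" for y i
    using n0[OF that]
    by (auto intro!: derivative_eq_intros simp: fun_eq_iff algebra_simps)
  \<comment> \<open>With \<open>z = y $ 2 + i * y $ 1\<close> one has \<open>1/z = q - i p\<close>;
    the formulas for \<open>p\<close> and \<open>q\<close> are the parts of
    \<open>d(1/z) = - dz / z^2\<close>. Signs sit in the constant factors, so that sums, products
    and constants suffice.\<close>
  have dp: "(?p has_derivative (\<lambda>v. (?q y * ?q y) * v $ 1 + (?p y * ?p y) * (- v $ 1)
      + (?p y * ?q y) * (- 2 * v $ 2))) (at y)" if "y \<in> upper_half_plane" for y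
    by (rule has_derivative_eq_rhs[OF quot[OF that]])
      (use n0[OF that] in \<open>simp add: fun_eq_iff divide_simps\<close>,
        simp add: algebra_simps power2_eq_square)
  have dq: "(?q has_derivative (\<lambda>v. (?p y * ?p y) * v $ 2 + (?q y * ?q y) * (- v $ 2)
      + (?p y * ?q y) * (- 2 * v $ 1))) (at y)" if "y \<in> upper_half_plane" for y
    by (rule has_derivative_eq_rhs[OF quot[OF that]])
      (use n0[OF that] in \<open>simp add: fun_eq_iff divide_simps\<close>,
        simp add: algebra_simps power2_eq_square)
  note intros = Ck_on_add Ck_on_mult Ck_on_const open_upper_half_plane
    Suc[THEN conjunct1] Suc[THEN conjunct2]
  have "Ck_on (Suc k) upper_half_plane ?p"
    by (rule Ck_on_SucI[OF open_upper_half_plane dp]) (assumption, intro intros)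
  moreover have "Ck_on (Suc k) upper_half_plane ?q"
    by (rule Ck_on_SucI[OF open_upper_half_plane dq]) (assumption, intro intros)
  ultimately show ?case ..
qed

text \<open>In complex terms this is \<open>d(log z) = dz / z\<close>. Grouping by the two functions
  of \<open>Ck_on_inversion\<close>, rather than by component, leaves constant vectors as the other
  factors.\<close>

lemma has_derivative_band_log:
  fixes y :: "real^2"
  assumes "y \<in> upper_half_plane"
  defines "n \<equiv> (y $ 1)\<^sup>2 + (y $ 2)\<^sup>2"
  shows "(band_log has_derivative (\<lambda>v. (y $ 1 / n) *\<^sub>R (v $ 1 *\<^sub>R axis 1 1 - v $ 2 *\<^sub>R axis 2 1)
    + (y $ 2 / n) *\<^sub>R (v $ 2 *\<^sub>R axis 1 1 + v $ 1 *\<^sub>R axis 2 1))) (at y)"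
proof -
  have y2: "y $ 2 > 0" using assms(1) by (simp add: upper_half_plane_def)
  then have n: "n > 0" by (simp add: n_def add_nonneg_pos)
  have ln: "((\<lambda>y::real^2. ln ((y $ 1)\<^sup>2 + (y $ 2)\<^sup>2) / 2) has_derivative
      (\<lambda>v. y $ 1 / n * v $ 1 + y $ 2 / n * v $ 2)) (at y)"
    using n unfolding n_def
    by (auto intro!: derivative_eq_intros simp: fun_eq_iff divide_simps)
      (simp_all add: algebra_simps)
  have arctan: "((\<lambda>y::real^2. arctan (y $ 1 / y $ 2)) has_derivative
      (\<lambda>v. y $ 2 / n * v $ 1 - y $ 1 / n * v $ 2)) (at y)"
  proof -
    \<comment> \<open>The outer factor in the chain rule for the arctangent.\<close>
    have "inverse (1 + (y $ 1 / y $ 2)\<^sup>2) = (y $ 2)\<^sup>2 / n"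
      using y2 n unfolding n_def by (simp add: field_simps power2_eq_square)
    then show ?thesis
      using y2 n by (auto intro!: derivative_eq_intros simp: fun_eq_iff)
        (simp add: field_simps power2_eq_square)
  qed
  show ?thesis
    unfolding band_log_def[abs_def]
    by (rule has_derivative_eq_rhs[OF has_derivative_add[OF
        has_derivative_scaleR_left[OF ln] has_derivative_scaleR_left[OF arctan]]])
      (simp add: fun_eq_iff algebra_simps)
qed

lemma smooth_on_band_log: "smooth_on upper_half_plane band_log"
proof -
  \<comment> \<open>The derivative is of every order \<open>k\<close>, which gives order
    \<open>Suc k\<close> without induction.\<close>
  have "Ck_on (Suc k) upper_half_plane band_log" for k
    by (rule Ck_on_SucI[OF open_upper_half_plane has_derivative_band_log], assumption)
      (intro Ck_on_add Ck_on_scaleR Ck_on_const open_upper_half_plane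
        Ck_on_inversion[THEN conjunct1] Ck_on_inversion[THEN conjunct2])
  then show ?thesis
    unfolding smooth_on_def using Ck_on_SucD by blast
qed

lemma diffeomorphism_on_band_exp: "diffeomorphism_on band upper_half_plane band_exp"
proof -
  \<comment> \<open>Injectivity of \<open>band_exp\<close> on the band leaves the choice in
    \<open>inv_into\<close> only one candidate.\<close>
  have "band_log y = inv_into band band_exp y" if "y \<in> upper_half_plane" for y
    using bij_betw_inv_into_left[OF bij_betw_band_exp band_log_in_band[of y]] band_exp_log[OF that]
    by simp
  then have "smooth_on upper_half_plane (inv_into band band_exp)"
    using smooth_on_band_log Ck_on_cong[OF open_upper_half_plane, of band_log]
    unfolding smooth_on_def by blast
  then show ?thesis
    by (simp add: diffeomorphism_on_def bij_betw_band_exp smooth_on_band_exp)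
qed

section \<open>The isometry\<close>

text \<open>The conformal factor stands in front so that it can be pulled out of the norm and the
  inner product; what remains is an orthogonal map.\<close>

lemma frechet_derivative_band_exp:
  "frechet_derivative band_exp (at x) v =
    exp (x $ 1) *\<^sub>R vector [sin (x $ 2) * v $ 1 + cos (x $ 2) * v $ 2,
                      cos (x $ 2) * v $ 1 - sin (x $ 2) * v $ 2]"
proof -
  have "(band_exp has_derivative
      (\<lambda>v. (exp (x $ 1) * (sin (x $ 2) * v $ 1 + cos (x $ 2) * v $ 2)) *\<^sub>R axis 1 1
         + (exp (x $ 1) * (cos (x $ 2) * v $ 1 - sin (x $ 2) * v $ 2)) *\<^sub>R axis 2 1)) (at x)"
    unfolding band_exp_def[abs_def]
    by (auto intro!: derivative_eq_intros simp: fun_eq_iff algebra_simps)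
  from frechet_derivative_at[OF this, symmetric] show ?thesis
    by (simp add: vec_eq_2_iff axis_def)
qed

lemma norm_vec_2: "norm x = sqrt ((x $ 1)\<^sup>2 + (x $ 2)\<^sup>2)" for x :: "real^2"
  by (simp add: norm_vec_def L2_set_def sum_2)

text \<open>The factor \<open>exp (x $ 1)\<close> of the derivative cancels against the height
  \<open>exp (x $ 1) * cos (x $ 2)\<close> in both denominators, and \<open>norm ?u = norm v\<close>
  settles the first term.\<close>

lemma F_upper_band_exp:
  assumes "x \<in> band"
  shows "F_upper (band_exp x) (frechet_derivative band_exp (at x) v) = F_band x v"
proof -
  let ?r = "exp (x $ 1)" and ?s = "sin (x $ 2)" and ?c = "cos (x $ 2)"
  let ?u = "vector [?s * v $ 1 + ?c * v $ 2, ?c * v $ 1 - ?s * v $ 2] :: real^2"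
  have c: "?c > 0" using assms by (rule cos_pos_band)
  have s2: "?s\<^sup>2 = 1 - ?c\<^sup>2" by (simp add: sin_squared_eq)
  have nb: "(norm (band_exp x))\<^sup>2 = ?r\<^sup>2"
    using sum_squares_band_exp[of x] by (simp add: norm_vec_2 exp_double)
  have "(?s * v $ 1 + ?c * v $ 2)\<^sup>2 + (?c * v $ 1 - ?s * v $ 2)\<^sup>2
      = (?s\<^sup>2 + ?c\<^sup>2) * ((v $ 1)\<^sup>2 + (v $ 2)\<^sup>2)"
    by algebra
  then have nu: "norm ?u = norm v"
    by (simp add: norm_vec_2)
  \<comment> \<open>With second coordinates as real parts, \<open>w_upper\<close> is
    \<open>z^2 - 4\<close> and \<open>?u\<close> is \<open>v\<close> rotated by
    \<open>x $ 2\<close>; the rotation cancels half of the double angle in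
    \<open>z^2\<close>.\<close>
  have "w_upper (band_exp x) \<bullet> ?u
      = 2 * ?r\<^sup>2 * ?s * ?c * (?s * v $ 1 + ?c * v $ 2)
        + (?r\<^sup>2 * ?c\<^sup>2 - ?r\<^sup>2 * ?s\<^sup>2 - 4) * (?c * v $ 1 - ?s * v $ 2)"
    by (simp add: w_upper_def inner_vec_def sum_2 power2_eq_square algebra_simps)
  \<comment> \<open>Keeping \<open>?s\<^sup>2 + ?c\<^sup>2\<close> unevaluated makes this a pure
    polynomial identity.\<close>
  also have "\<dots> = (?r\<^sup>2 * (?s\<^sup>2 + ?c\<^sup>2) - 4) * v $ 1 * ?c + (?r\<^sup>2 * (?s\<^sup>2 + ?c\<^sup>2) + 4) * v $ 2 * ?s"
    by algebra
  finally have w: "w_upper (band_exp x) \<bullet> ?u = (?r\<^sup>2 - 4) * v $ 1 * ?c + (?r\<^sup>2 + 4) * v $ 2 * ?s"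
    by simp
  show ?thesis
    unfolding F_upper_def F_band_def frechet_derivative_band_exp norm_scaleR nb nu inner_scaleR_right w
      exp_double band_exp_nth
    using c by (simp add: ac_simps)
qed

theorem proposition3p4:
  "\<exists>\<phi> :: real^2 \<Rightarrow> real^2. diffeomorphism_on band upper_half_plane \<phi> \<and>
     (\<forall>x\<in>band. \<forall>v :: real^2. F_upper (\<phi> x) (frechet_derivative \<phi> (at x) v) = F_band x v)"
  using diffeomorphism_on_band_exp F_upper_band_exp by blast

end
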